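(* Let $\mathbb{F}$ be a field, let $G$ be a group and let $x\in G$ be an element of finite order $n:=o(x)>2$. Suppose that $\alpha\in\mathbb{F}[G]$ with $1\in supp(\alpha)\subseteq\langle x\rangle$ is a zero divisor, so that $\alpha\beta=0$ for some non-zero $\beta\in\mathbb{F}[G]$, where $1\in supp(\beta)$ and $|supp(\beta)|$ is minimum among all non-zero elements of $\mathbb{F}[G]$ with the property $\alpha\beta=0$. Then there exists at least one irreducible factor of $X^n-1$ in $\mathbb{F}[X]$ which divides $\alpha(X)$. Also, there exists at least one irreducible factor of $X^n-1$ in $\mathbb{F}[X]$ which divides $\beta(X)$.
   Context: The support of $\alpha=\sum_{g\in G}\alpha_g g\in \mathbb{F}[G]$ is $supp(\alpha)=\{g\in G : \alpha_g\neq 0\}$. A non-zero element $\alpha\in \mathbb{F}[G]$ is called a zero divisor if $\alpha\beta=0$ for some non-zero $\beta\in \mathbb{F}[G]$. For $\gamma=\sum_{k=0}^{n-1}a_kx^k\in\mathbb{F}[\langle x\rangle]$, $\gamma(X)$ denotes the polynomial $\sum_{k=0}^{n-1}a_kX^k\in\mathbb{F}[X]$. It is a known fact (from earlier work) that under the stated hypotheses on $\beta$ one has $supp(\beta)\subseteq\langle supp(\alpha)\rangle\subseteq\langle x\rangle$, so that $\beta(X)$ is defined. *)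

theory Defs
  imports
    "HOL-Algebra.Multiplicative_Group"
    "HOL-Algebra.Generated_Groups"
    "HOL-Computational_Algebra.Polynomial_Factorial"
    "HOL-Library.Poly_Mapping"
begin

hide_const (open) UnivPoly.monom UnivPoly.coeff

text \<open>
  The group algebra \<open>F[G]\<close> is the convolution ring \<open>'g \<Rightarrow>\<^sub>0 'f\<close> with \<open>'g\<close> of class \<open>group_add\<close>
  and \<open>'f\<close> of class \<open>field\<close>; the support is \<open>keys\<close>. As the product on \<open>'g \<Rightarrow>\<^sub>0 'f\<close> is induced
  by \<open>+\<close> on \<open>'g\<close>, the group is written additively, with identity \<open>0\<close>, but class \<open>group_add\<close>
  does not assume commutativity. The following presents the same group as a group record, in
  order to speak about element orders, powers and generated subgroups.
\<close>

definition grp :: "'g::group_add monoid" where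
  "grp = \<lparr>carrier = UNIV, monoid.mult = (+), one = 0\<rparr>"

definition zero_divisor :: "'a::mult_zero \<Rightarrow> bool" where
  "zero_divisor a \<longleftrightarrow> a \<noteq> 0 \<and> (\<exists>b. b \<noteq> 0 \<and> a * b = 0)"

text \<open>
  \<open>assoc_poly x \<gamma>\<close> is the polynomial \<open>\<gamma>(X)\<close>. It is meaningful if \<open>x\<close> has finite order and
  the support of \<open>\<gamma>\<close> lies in the subgroup generated by \<open>x\<close>; see \<open>keys_annihilator_subset\<close>
  below for minimal annihilators.
\<close>

definition assoc_poly :: "'g::group_add \<Rightarrow> ('g \<Rightarrow>\<^sub>0 'f::field) \<Rightarrow> 'f poly" where
  "assoc_poly x \<gamma> = (\<Sum>k<group.ord grp x. monom (Poly_Mapping.lookup \<gamma> (x [^]\<^bsub>grp\<^esub> k)) k)"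

lemma group_grp: "group (grp :: 'g::group_add monoid)"
  by (rule groupI) (auto simp: grp_def add.assoc intro: exI[of _ "- _"] left_minus)

lemma inv_grp: "inv\<^bsub>grp\<^esub> (g :: 'g::group_add) = - g"
  by (rule group.inv_equality[OF group_grp]) (auto simp: grp_def)

lemma generate_grp_diff_iff:
  fixes l g :: "'g::group_add"
  assumes "l \<in> generate grp A"
  shows "- l + g \<in> generate grp A \<longleftrightarrow> g \<in> generate grp A"
proof -
  have sub: "subgroup (generate grp A) (grp :: 'g monoid)"
    by (rule group.generate_is_subgroup[OF group_grp]) (simp add: grp_def)
  have add: "a + b \<in> generate grp A" if "a \<in> generate grp A" "b \<in> generate grp A" for a b :: 'g
    using subgroup.m_closed[OF sub that] by (simp add: grp_def)
  have neg: "- l \<in> generate grp A"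
    using subgroup.m_inv_closed[OF sub assms] by (simp add: inv_grp)
  show ?thesis
    using add[OF neg, of g] add[OF assms, of "- l + g"] by (auto simp flip: add.assoc)
qed

lemma lookup_times_group:
  fixes \<alpha> \<gamma> :: "'g::group_add \<Rightarrow>\<^sub>0 'f::field"
  shows "Poly_Mapping.lookup (\<alpha> * \<gamma>) g = (\<Sum>l\<in>Poly_Mapping.keys \<alpha>. Poly_Mapping.lookup \<alpha> l * Poly_Mapping.lookup \<gamma> (- l + g))"
proof -
  have "Poly_Mapping.lookup (\<alpha> * \<gamma>) g = (\<Sum>l. Poly_Mapping.lookup \<alpha> l * (\<Sum>q. Poly_Mapping.lookup \<gamma> q when g = l + q))"
    by (simp add: Poly_Mapping.lookup_mult)
  also have "(\<lambda>l. (\<Sum>q. Poly_Mapping.lookup \<gamma> q when g = l + q)) = (\<lambda>l. Poly_Mapping.lookup \<gamma> (- l + g))"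
  proof
    fix l
    have "(g = l + q) = (q = - l + g)" for q
      by (metis add.assoc add.left_inverse add.right_inverse add_0)
    then show "(\<Sum>q. Poly_Mapping.lookup \<gamma> q when g = l + q) = Poly_Mapping.lookup \<gamma> (- l + g)"
      by simp
  qed
  then have "(\<Sum>l. Poly_Mapping.lookup \<alpha> l * (\<Sum>q. Poly_Mapping.lookup \<gamma> q when g = l + q)) =
      (\<Sum>l. Poly_Mapping.lookup \<alpha> l * Poly_Mapping.lookup \<gamma> (- l + g))"
    by (simp add: fun_eq_iff)
  also have "\<dots> = (\<Sum>l\<in>Poly_Mapping.keys \<alpha>. Poly_Mapping.lookup \<alpha> l * Poly_Mapping.lookup \<gamma> (- l + g))"
    by (rule Sum_any.expand_superset) (auto simp: in_keys_iff)
  finally show ?thesis .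
qed

lemma keys_annihilator_subset:
  fixes \<alpha> \<beta> :: "'g::group_add \<Rightarrow>\<^sub>0 'f::field"
  assumes "\<alpha> * \<beta> = 0" and "0 \<in> Poly_Mapping.keys \<beta>"
    and min: "\<And>\<gamma>. \<gamma> \<noteq> 0 \<Longrightarrow> \<alpha> * \<gamma> = 0 \<Longrightarrow> card (Poly_Mapping.keys \<beta>) \<le> card (Poly_Mapping.keys \<gamma>)"
  shows "Poly_Mapping.keys \<beta> \<subseteq> generate grp (Poly_Mapping.keys \<alpha>)"
proof -
  define H where "H = generate grp (Poly_Mapping.keys \<alpha>)"
  define \<gamma> where "\<gamma> = Abs_poly_mapping (\<lambda>g. Poly_Mapping.lookup \<beta> g when g \<in> H)"
  have fin: "finite {g. (Poly_Mapping.lookup \<beta> g when g \<in> H) \<noteq> 0}"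
    by (rule finite_subset[OF _ finite_keys[of \<beta>]]) (auto simp: in_keys_iff)
  have lookup: "Poly_Mapping.lookup \<gamma> g = (Poly_Mapping.lookup \<beta> g when g \<in> H)" for g
    unfolding \<gamma>_def using fin by simp
  have keys: "Poly_Mapping.keys \<gamma> = Poly_Mapping.keys \<beta> \<inter> H"
    by (auto simp: in_keys_iff lookup)
  have "0 \<in> H"
    using generate.one[of grp "Poly_Mapping.keys \<alpha>"] by (simp add: H_def grp_def)
  then have "\<gamma> \<noteq> 0"
    using assms(2) keys by auto
  moreover have "\<alpha> * \<gamma> = 0"
  proof (rule poly_mapping_eqI)
    fix g
    have "- l + g \<in> H \<longleftrightarrow> g \<in> H" if "l \<in> Poly_Mapping.keys \<alpha>" for l
      unfolding H_def using that by (intro generate_grp_diff_iff generate.incl)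
    then have "Poly_Mapping.lookup (\<alpha> * \<gamma>) g = (Poly_Mapping.lookup (\<alpha> * \<beta>) g when g \<in> H)"
      by (auto simp: lookup_times_group lookup when_def intro!: sum.cong)
    then show "Poly_Mapping.lookup (\<alpha> * \<gamma>) g = Poly_Mapping.lookup 0 g"
      using assms(1) by simp
  qed
  ultimately have "card (Poly_Mapping.keys \<beta>) \<le> card (Poly_Mapping.keys \<beta> \<inter> H)"
    using min keys by metis
  then show ?thesis
    unfolding H_def[symmetric]
    by (metis card_seteq finite_keys inf_le1 inf_le2)
qed

end

theory Submission
  imports Defs
begin

text \<open>
  The substitution \<open>X \<mapsto> x\<close> is a ring homomorphism \<open>\<Phi>\<close> from \<open>F[X]\<close> to \<open>F[G]\<close>. It kills
  \<open>X\<^sup>n - 1\<close>, where \<open>n\<close> is the order of \<open>x\<close>, and it sends \<open>\<gamma>(X)\<close> back to \<open>\<gamma>\<close> whenever the support of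
  \<open>\<gamma>\<close> lies in the cyclic group generated by \<open>x\<close>. If such a \<open>\<gamma>(X)\<close> shares no irreducible factor with
  \<open>X\<^sup>n - 1\<close>, then Bezout's identity \<open>u \<gamma>(X) + v (X\<^sup>n - 1) = 1\<close> becomes \<open>\<Phi>(u) \<gamma> = 1\<close>, so \<open>\<gamma>\<close> is
  a unit of \<open>F[G]\<close> (lemma \<open>common_factor_or_unit\<close>); the inverse is two-sided because
  the polynomials commute. But \<open>\<alpha> \<beta> = 0\<close> with both factors nonzero, so neither factor is a
  unit. The same argument serves for \<open>\<beta>\<close> because the minimality of its support confines
  that support to the group generated by the support of \<open>\<alpha>\<close>.
\<close>

lemma nonunit_poly_has_irreducible_factor:
  fixes f :: "'f::field poly"
  assumes "f \<noteq> 0" "\<not> f dvd 1"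
  shows "\<exists>p. irreducible p \<and> p dvd f"
  using assms
proof (induction "degree f" arbitrary: f rule: less_induct)
  case less
  show ?case
  proof (cases "irreducible f")
    case False
    then obtain a b where ab: "f = a * b" "\<not> a dvd 1" "\<not> b dvd 1"
      using less.prems by (auto simp: irreducible_def)
    with less.prems have nz: "a \<noteq> 0" "b \<noteq> 0" by auto
    then have "degree b > 0"
      using ab(3) by (simp add: is_unit_iff_degree)
    then have "degree a < degree f"
      using ab(1) nz by (simp add: degree_mult_eq)
    from less.hyps[OF this nz(1) ab(2)] show ?thesis
      using ab(1) by (auto intro: dvd_mult2)
  qed auto
qed

text \<open>
  The combinations \<open>u a + v b\<close> form an ideal, and a nonzero element of least degree in it divides
  both \<open>a\<close> and \<open>b\<close>, since remainders modulo that element stay in the ideal. So this element is a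
  greatest common divisor: a unit, or a multiple of some irreducible polynomial.
\<close>

lemma common_irreducible_factor_or_bezout:
  fixes a b :: "'f::field poly"
  assumes "b \<noteq> 0"
  shows "(\<exists>p. irreducible p \<and> p dvd b \<and> p dvd a) \<or> (\<exists>u v. u * a + v * b = 1)"
proof -
  define I where "I = {u * a + v * b | u v. True}"
  have combination: "u * a + v * b \<in> I" for u v
    by (auto simp: I_def)
  have a: "a \<in> I" and b: "b \<in> I"
    using combination[of 1 0] combination[of 0 1] by simp_all
  obtain d where d: "d \<in> I" "d \<noteq> 0"
    and least: "\<And>e. e \<in> I \<Longrightarrow> e \<noteq> 0 \<Longrightarrow> degree d \<le> degree e"
    using ex_has_least_nat[of "\<lambda>e. e \<in> I \<and> e \<noteq> 0" b degree] b assms by blast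
  from d(1) obtain s t where st: "d = s * a + t * b"
    by (auto simp: I_def)
  have divides: "d dvd e" if "e \<in> I" for e
  proof -
    from that obtain u v where uv: "e = u * a + v * b"
      by (auto simp: I_def)
    have "e mod d = e - e div d * d"
      by (simp add: minus_div_mult_eq_mod)
    also have "\<dots> = (u - e div d * s) * a + (v - e div d * t) * b"
      by (simp add: st uv algebra_simps)
    finally have "e mod d \<in> I"
      using combination by simp
    then have "e mod d = 0"
      using least[of "e mod d"] degree_mod_less[OF d(2), of e] by fastforce
    then show ?thesis by auto
  qed
  show ?thesis
  proof (cases "d dvd 1")
    case True
    then obtain c where "1 = d * c" by (elim dvdE)
    then have "(c * s) * a + (c * t) * b = 1"
      by (simp add: st algebra_simps)
    then show ?thesis by blast
  next
    case False
    then obtain p where "irreducible p" "p dvd d"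
      using nonunit_poly_has_irreducible_factor d(2) by blast
    with divides[OF a] divides[OF b] show ?thesis
      by (meson dvd_trans)
  qed
qed

text \<open>
  The ring \<open>F[G]\<close> need not be commutative, which excludes evaluation by \<open>poly\<close>, so
  substitution is defined by Horner's scheme.
\<close>

definition subst_group :: "'g::group_add \<Rightarrow> 'f::field poly \<Rightarrow> 'g \<Rightarrow>\<^sub>0 'f" where
  "subst_group x p =
     fold_coeffs (\<lambda>a s. Poly_Mapping.single 0 a + Poly_Mapping.single x 1 * s) p 0"

lemma subst_group_0 [simp]: "subst_group x 0 = 0"
  by (simp add: subst_group_def)

lemma subst_group_pCons [simp]:
  "subst_group x (pCons a p) = Poly_Mapping.single 0 a + Poly_Mapping.single x 1 * subst_group x p"
  by (cases "p = 0 \<and> a = 0") (auto simp: subst_group_def)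

lemma subst_group_add: "subst_group x (p + q) = subst_group x p + subst_group x q"
  by (induction p q rule: poly_induct2) (simp_all add: single_add algebra_simps)

lemma subst_group_sum: "subst_group x (\<Sum>k\<in>A. f k) = (\<Sum>k\<in>A. subst_group x (f k))"
  by (induction A rule: infinite_finite_induct) (simp_all add: subst_group_add)

lemma subst_group_smult: "subst_group x (smult c p) = Poly_Mapping.single 0 c * subst_group x p"
proof (induction p)
  case (pCons a p)
  \<comment> \<open>Scalars are central: they sit at the identity of the group.\<close>
  have "Poly_Mapping.single x 1 * (Poly_Mapping.single 0 c * subst_group x p) =
      Poly_Mapping.single 0 c * (Poly_Mapping.single x 1 * subst_group x p)"
    by (simp add: mult_single flip: mult.assoc)
  with pCons.IH show ?case
    by (simp add: mult_single distrib_left)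
qed simp

lemma subst_group_mult: "subst_group x (p * q) = subst_group x p * subst_group x q"
  by (induction p) (simp_all add: subst_group_add subst_group_smult distrib_right mult.assoc)

lemma subst_group_1 [simp]: "subst_group x 1 = 1"
  by (simp add: one_pCons)

lemma subst_group_monom: "subst_group x (monom c k) = Poly_Mapping.single (x [^]\<^bsub>grp\<^esub> k) c"
proof (induction k)
  case 0
  show ?case by (simp add: monom_0 grp_def)
next
  case (Suc k)
  have "x [^]\<^bsub>grp\<^esub> Suc k = x + x [^]\<^bsub>grp\<^esub> k"
    using monoid.nat_pow_Suc2[OF group.is_monoid[OF group_grp], of x k] by (simp add: grp_def)
  with Suc show ?case by (simp add: monom_Suc mult_single)
qed

lemma subst_group_ord: "subst_group x (monom 1 (group.ord grp x) - 1) = 0"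
proof -
  have "x [^]\<^bsub>grp\<^esub> group.ord grp x = 0"
    using group.pow_ord_eq_1[OF group_grp, of x] by (simp add: grp_def)
  then have "subst_group x (monom 1 (group.ord grp x) - 1 + 1) = 1"
    by (simp add: subst_group_monom)
  then show ?thesis
    unfolding subst_group_add by simp
qed

lemma bij_betw_powers_generate:
  assumes "group.ord grp x > 0"
  shows "bij_betw (\<lambda>k. x [^]\<^bsub>grp\<^esub> k) {..<group.ord grp x} (generate grp {x})"
proof -
  interpret group "grp :: 'a monoid" by (rule group_grp)
  have x: "x \<in> carrier grp" by (simp add: grp_def)
  have range: "{0..group.ord grp x - 1} = {..<group.ord grp x}"
    using assms by auto
  have "generate grp {x} = (\<lambda>k. x [^]\<^bsub>grp\<^esub> k) ` {..<group.ord grp x}"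
    using generate_pow_nat[OF x] ord_elems_inf_carrier[OF x] assms by (auto simp flip: range)
  then show ?thesis
    using ord_inj[OF x] unfolding bij_betw_def range by blast
qed

lemma subst_group_assoc_poly:
  assumes "group.ord grp x > 0" "Poly_Mapping.keys \<gamma> \<subseteq> generate grp {x}"
  shows "subst_group x (assoc_poly x \<gamma>) = \<gamma>"
proof -
  have "subst_group x (assoc_poly x \<gamma>) =
      (\<Sum>g\<in>generate grp {x}. Poly_Mapping.single g (Poly_Mapping.lookup \<gamma> g))"
    unfolding assoc_poly_def subst_group_sum subst_group_monom
    by (rule sum.reindex_bij_betw[OF bij_betw_powers_generate[OF assms(1)]])
  also have "\<dots> = (\<Sum>g\<in>Poly_Mapping.keys \<gamma>. Poly_Mapping.single g (Poly_Mapping.lookup \<gamma> g))"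
    using bij_betw_finite[OF bij_betw_powers_generate[OF assms(1)]] assms(2)
    by (intro sum.mono_neutral_right) (auto simp: in_keys_iff)
  also have "\<dots> = \<gamma>"
    by (rule poly_mapping_eqI)
      (auto simp: lookup_sum lookup_single when_def in_keys_iff sum.delta')
  finally show ?thesis .
qed

text \<open>
  In a Bezout identity between \<open>\<gamma>(X)\<close> and \<open>X\<^sup>n - 1\<close>, the term with \<open>X\<^sup>n - 1\<close> vanishes under
  \<open>X \<mapsto> x\<close>; the cofactor of \<open>\<gamma>(X)\<close> is sent to the inverse.
\<close>

lemma common_factor_or_unit:
  fixes \<gamma> :: "'g::group_add \<Rightarrow>\<^sub>0 'f::field"
  assumes "group.ord grp x > 0" "Poly_Mapping.keys \<gamma> \<subseteq> generate grp {x}"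
  shows "(\<exists>p. irreducible p \<and> p dvd monom 1 (group.ord grp x) - 1 \<and> p dvd assoc_poly x \<gamma>) \<or>
         (\<exists>\<delta>. \<delta> * \<gamma> = 1 \<and> \<gamma> * \<delta> = 1)"
proof -
  define M where "M = monom (1::'f) (group.ord grp x) - 1"
  have "coeff M (group.ord grp x) = 1"
    using assms(1) by (simp add: M_def)
  then have "M \<noteq> 0" by auto
  then consider "\<exists>p. irreducible p \<and> p dvd M \<and> p dvd assoc_poly x \<gamma>"
    | u v where "u * assoc_poly x \<gamma> + v * M = 1"
    using common_irreducible_factor_or_bezout[OF \<open>M \<noteq> 0\<close>, of "assoc_poly x \<gamma>"]
    by (elim disjE exE) auto
  then show ?thesis
  proof cases
    case 2
    have M: "subst_group x M = 0"
      unfolding M_def by (rule subst_group_ord)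
    have "subst_group x (u * assoc_poly x \<gamma> + v * M) = 1"
      using 2 by simp
    then have "subst_group x (u * assoc_poly x \<gamma>) = 1"
      by (simp add: subst_group_add subst_group_mult[of x v] M)
    moreover from this have "subst_group x (assoc_poly x \<gamma> * u) = 1"
      by (simp add: mult.commute)
    ultimately show ?thesis
      unfolding subst_group_mult subst_group_assoc_poly[OF assms] by blast
  qed (simp add: M_def)
qed

theorem proposition1p3:
  fixes \<alpha> \<beta> :: "'g::group_add \<Rightarrow>\<^sub>0 'f::field" and x :: 'g and n :: nat
  assumes "n = group.ord grp x" and "n > 2"
    and "0 \<in> Poly_Mapping.keys \<alpha>" and "Poly_Mapping.keys \<alpha> \<subseteq> generate grp {x}"
    and "zero_divisor \<alpha>"
    and "\<beta> \<noteq> 0" and "\<alpha> * \<beta> = 0" and "0 \<in> Poly_Mapping.keys \<beta>"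
    and "\<And>\<gamma>. \<gamma> \<noteq> 0 \<Longrightarrow> \<alpha> * \<gamma> = 0 \<Longrightarrow> card (Poly_Mapping.keys \<beta>) \<le> card (Poly_Mapping.keys \<gamma>)"
  shows "(\<exists>p. irreducible p \<and> p dvd monom 1 n - 1 \<and> p dvd assoc_poly x \<alpha>) \<and>
         (\<exists>p. irreducible p \<and> p dvd monom 1 n - 1 \<and> p dvd assoc_poly x \<beta>)"
proof -
  have ord: "group.ord grp x > 0"
    using assms(1,2) by simp
  have "subgroup (generate grp {x}) (grp :: 'g monoid)"
    by (rule group.generate_is_subgroup[OF group_grp]) (simp add: grp_def)
  then have "generate grp (Poly_Mapping.keys \<alpha>) \<subseteq> generate grp {x}"
    using group.generate_subgroup_incl[OF group_grp assms(4)] by blast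
  with keys_annihilator_subset[OF assms(7,8,9)]
  have keys_\<beta>: "Poly_Mapping.keys \<beta> \<subseteq> generate grp {x}"
    by blast
  have "\<nexists>\<delta>. \<delta> * \<alpha> = 1 \<and> \<alpha> * \<delta> = 1"
  proof
    assume "\<exists>\<delta>. \<delta> * \<alpha> = 1 \<and> \<alpha> * \<delta> = 1"
    then obtain \<delta> where "\<delta> * \<alpha> = 1" by blast
    then have "\<beta> = \<delta> * (\<alpha> * \<beta>)"
      by (simp flip: mult.assoc)
    with assms(6,7) show False by simp
  qed
  moreover have "\<nexists>\<delta>. \<delta> * \<beta> = 1 \<and> \<beta> * \<delta> = 1"
  proof
    assume "\<exists>\<delta>. \<delta> * \<beta> = 1 \<and> \<beta> * \<delta> = 1"
    then obtain \<delta> where "\<beta> * \<delta> = 1" by blast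
    then have "\<alpha> = (\<alpha> * \<beta>) * \<delta>"
      by (simp add: mult.assoc)
    with assms(5,7) show False by (simp add: zero_divisor_def)
  qed
  ultimately show ?thesis
    using common_factor_or_unit[OF ord assms(4)] common_factor_or_unit[OF ord keys_\<beta>] assms(1)
    by blast
qed

end
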